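(* Given a set $P$ of $n$ points on the $x$-axis, a $1$-ply cover of $P$ with the minimum number of unit intervals can be computed in $O(n\log n)$ time.
   Context: A unit interval is a closed interval $[a,a+1]$, $a\in\mathbb{R}$. For a set $\mathcal{S}$ of intervals on the line, $\mathsf{ply}(\mathcal{S})=\max_{p}|\{s\in\mathcal{S}: p\in s\}|$, the maximum being over all points $p$ of the line. A $1$-ply cover of $P$ with unit intervals is a finite set $\mathcal{S}$ of unit intervals whose union contains $P$ and with $\mathsf{ply}(\mathcal{S})\le 1$, i.e. the intervals are pairwise disjoint (they do not even touch at endpoints). The intervals may be placed anywhere on the line. *)

theory Defs
  imports Complex_Main "HOL-Library.Landau_Symbols"
begin

definition unit_interval :: "real \<Rightarrow> real set" where
  "unit_interval a = {a..a + 1}"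

(* The maximum is attained for finite S, the only case in which ply is used below. *)
definition ply :: "real set set \<Rightarrow> nat" where
  "ply S = Max (range (\<lambda>p. card {s \<in> S. p \<in> s}))"

definition one_ply_cover :: "real set \<Rightarrow> real set set \<Rightarrow> bool" where
  "one_ply_cover P S \<longleftrightarrow>
     finite S \<and> S \<subseteq> range unit_interval \<and> P \<subseteq> \<Union>S \<and> ply S \<le> 1"

definition min_one_ply_cover :: "real set \<Rightarrow> real set set \<Rightarrow> bool" where
  "min_one_ply_cover P S \<longleftrightarrow> is_arg_min card (one_ply_cover P) S"

(* The model of computation is a real RAM, programmed in a WHILE language.  The machine has
   a memory of natural numbers (counters, addresses) and a memory of exact real numbers, both
   with indirect addressing.  The reals admit the four arithmetic operations and comparison,
   but no rounding and no conversion to addresses; the natural numbers admit only addition,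
   truncated subtraction and comparison, so that large integers cannot be used to encode data
   cheaply.  A program is a fixed finite syntactic object, independent of the input length. *)

record state =
  imem :: "nat \<Rightarrow> nat"
  rmem :: "nat \<Rightarrow> real"

datatype iexp =
    IConst nat
  | ICell iexp
  | IPlus iexp iexp
  | IMinus iexp iexp

datatype rexp =
    RConst int
  | RCell iexp
  | RPlus rexp rexp
  | RMinus rexp rexp
  | RTimes rexp rexp
  | RDivide rexp rexp

datatype bexp =
    ILess iexp iexp
  | RLess rexp rexp
  | BNot bexp
  | BAnd bexp bexp

datatype com =
    SKIP
  | IStore iexp iexp
  | RStore iexp rexp
  | SEQ com com
  | IF bexp com com
  | WHILE bexp com

primrec ival :: "iexp \<Rightarrow> state \<Rightarrow> nat" where
  "ival (IConst k) s = k"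
| "ival (ICell a) s = imem s (ival a s)"
| "ival (IPlus a b) s = ival a s + ival b s"
| "ival (IMinus a b) s = ival a s - ival b s"

primrec rval :: "rexp \<Rightarrow> state \<Rightarrow> real" where
  "rval (RConst z) s = of_int z"
| "rval (RCell a) s = rmem s (ival a s)"
| "rval (RPlus a b) s = rval a s + rval b s"
| "rval (RMinus a b) s = rval a s - rval b s"
| "rval (RTimes a b) s = rval a s * rval b s"
| "rval (RDivide a b) s = rval a s / rval b s"

primrec bval :: "bexp \<Rightarrow> state \<Rightarrow> bool" where
  "bval (ILess a b) s \<longleftrightarrow> ival a s < ival b s"
| "bval (RLess a b) s \<longleftrightarrow> rval a s < rval b s"
| "bval (BNot b) s \<longleftrightarrow> \<not> bval b s"
| "bval (BAnd b c) s \<longleftrightarrow> bval b s \<and> bval c s"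

(* Unit cost: every constant, memory access, arithmetic operation and comparison takes one
   time unit, whatever the size of its operands. *)

primrec icost :: "iexp \<Rightarrow> nat" where
  "icost (IConst k) = 1"
| "icost (ICell a) = 1 + icost a"
| "icost (IPlus a b) = 1 + icost a + icost b"
| "icost (IMinus a b) = 1 + icost a + icost b"

primrec rcost :: "rexp \<Rightarrow> nat" where
  "rcost (RConst z) = 1"
| "rcost (RCell a) = 1 + icost a"
| "rcost (RPlus a b) = 1 + rcost a + rcost b"
| "rcost (RMinus a b) = 1 + rcost a + rcost b"
| "rcost (RTimes a b) = 1 + rcost a + rcost b"
| "rcost (RDivide a b) = 1 + rcost a + rcost b"

primrec bcost :: "bexp \<Rightarrow> nat" where
  "bcost (ILess a b) = 1 + icost a + icost b"
| "bcost (RLess a b) = 1 + rcost a + rcost b"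
| "bcost (BNot b) = 1 + bcost b"
| "bcost (BAnd b c) = 1 + bcost b + bcost c"

(* exec c s t s': started in s, the program c halts after t time units in state s'. *)
inductive exec :: "com \<Rightarrow> state \<Rightarrow> nat \<Rightarrow> state \<Rightarrow> bool" where
  Skip: "exec SKIP s 1 s"
| IStore: "exec (IStore a e) s (1 + icost a + icost e)
             (s\<lparr>imem := (imem s)(ival a s := ival e s)\<rparr>)"
| RStore: "exec (RStore a e) s (1 + icost a + rcost e)
             (s\<lparr>rmem := (rmem s)(ival a s := rval e s)\<rparr>)"
| Seq: "exec c1 s1 t1 s2 \<Longrightarrow> exec c2 s2 t2 s3 \<Longrightarrow> exec (SEQ c1 c2) s1 (t1 + t2) s3"
| IfTrue: "bval b s \<Longrightarrow> exec c1 s t s' \<Longrightarrow> exec (IF b c1 c2) s (1 + bcost b + t) s'"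
| IfFalse: "\<not> bval b s \<Longrightarrow> exec c2 s t s' \<Longrightarrow> exec (IF b c1 c2) s (1 + bcost b + t) s'"
| WhileFalse: "\<not> bval b s \<Longrightarrow> exec (WHILE b c) s (1 + bcost b) s"
| WhileTrue: "bval b s1 \<Longrightarrow> exec c s1 t1 s2 \<Longrightarrow> exec (WHILE b c) s2 t2 s3 \<Longrightarrow>
             exec (WHILE b c) s1 (1 + bcost b + t1 + t2) s3"

inductive_cases SkipE: "exec SKIP s t s'"
inductive_cases IStoreE: "exec (IStore a e) s t s'"
inductive_cases RStoreE: "exec (RStore a e) s t s'"
inductive_cases SeqE: "exec (SEQ c1 c2) s t s'"
inductive_cases IfE: "exec (IF b c1 c2) s t s'"
inductive_cases WhileE: "exec (WHILE b c) s t s'"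

lemma exec_deterministic:
  "exec c s t s' \<Longrightarrow> exec c s u s'' \<Longrightarrow> t = u \<and> s' = s''"
proof (induction arbitrary: u s'' rule: exec.induct)
  case Skip
  then show ?case by (auto elim: SkipE)
next
  case IStore
  then show ?case by (auto elim: IStoreE)
next
  case RStore
  then show ?case by (auto elim: RStoreE)
next
  case (Seq c1 s1 t1 s2 c2 t2 s3)
  from Seq.prems obtain u1 u2 r where "exec c1 s1 u1 r" "exec c2 r u2 s''" "u = u1 + u2"
    by (rule SeqE)
  with Seq.IH show ?case by metis
next
  case (IfTrue b s c1 t s' c2)
  from IfTrue.prems IfTrue.hyps obtain v where "exec c1 s v s''" "u = 1 + bcost b + v"
    by (auto elim: IfE)
  with IfTrue.IH show ?case by metis
next
  case (IfFalse b s c2 t s' c1)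
  from IfFalse.prems IfFalse.hyps obtain v where "exec c2 s v s''" "u = 1 + bcost b + v"
    by (auto elim: IfE)
  with IfFalse.IH show ?case by metis
next
  case (WhileFalse b s c)
  from WhileFalse.prems show ?case
    by (rule WhileE) (simp_all add: WhileFalse.hyps)
next
  case (WhileTrue b s1 c t1 s2 t2 s3)
  from WhileTrue.prems obtain u1 u2 r where
    "exec c s1 u1 r" "exec (WHILE b c) r u2 s''" "u = 1 + bcost b + u1 + u2"
    by (rule WhileE) (simp_all add: WhileTrue.hyps)
  with WhileTrue.IH show ?case by metis
qed

(* Input: the length in integer cell 0 and the entries in the first real cells. *)
definition input_state :: "real list \<Rightarrow> state" where
  "input_state xs =
     \<lparr>imem = (\<lambda>i. if i = 0 then length xs else 0),
      rmem = (\<lambda>i. if i < length xs then xs ! i else 0)\<rparr>"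

(* Output, in the same format: a list of reals, to be read as left endpoints of intervals. *)
definition output_list :: "state \<Rightarrow> real list" where
  "output_list s = map (rmem s) [0..<imem s 0]"

end

theory Submission
  imports Defs "HOL-Library.Log_Nat"
begin

text \<open>After sorting, scan the points from left to right and open an interval \<open>[x, x + 1]\<close> whenever
  \<open>x\<close> lies beyond the last interval. Each new interval starts strictly to the right of the previous
  one, so the intervals are pairwise disjoint and the usual greedy cover is already \<open>1\<close>-ply; it is
  minimum among all covers because its left endpoints are points of \<open>P\<close> more than \<open>1\<close> apart. The cost
  is dominated by a bottom-up merge sort, in which every pass writes to a fresh part of the real
  memory.\<close>

section \<open>Weakest preconditions with time credits\<close>

text \<open>In \<open>wp c Q t s\<close>, the number \<open>t\<close> is a stock of time units from which the execution of \<open>c\<close> is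
  paid; the postcondition receives what is left of it.\<close>

definition wp :: "com \<Rightarrow> (nat \<Rightarrow> state \<Rightarrow> bool) \<Rightarrow> nat \<Rightarrow> state \<Rightarrow> bool" where
  "wp c Q t s \<longleftrightarrow> (\<exists>u s'. exec c s u s' \<and> u \<le> t \<and> Q (t - u) s')"

lemma wp_IStore [simp]:
  "wp (IStore a e) Q t s \<longleftrightarrow> 1 + icost a + icost e \<le> t \<and>
     Q (t - (1 + icost a + icost e)) (s\<lparr>imem := (imem s)(ival a s := ival e s)\<rparr>)"
  unfolding wp_def by (metis exec.IStore IStoreE)

text \<open>Replaces \<open>wp_IStore\<close> where a loop is entered: only the constant stores
  before the loop are executed, and assignments after it stay folded in its postcondition, as the
  loop fact states them.\<close>

lemma wp_IStore_const:
  "wp (IStore (IConst x) (IConst c)) Q t s \<longleftrightarrow> 3 \<le> t \<and> Q (t - 3) (s\<lparr>imem := (imem s)(x := c)\<rparr>)"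
  by (simp add: numeral_eq_Suc)

lemma wp_RStore [simp]:
  "wp (RStore a e) Q t s \<longleftrightarrow> 1 + icost a + rcost e \<le> t \<and>
     Q (t - (1 + icost a + rcost e)) (s\<lparr>rmem := (rmem s)(ival a s := rval e s)\<rparr>)"
  unfolding wp_def by (metis exec.RStore RStoreE)

lemma wp_SKIP [simp]: "wp SKIP Q t s \<longleftrightarrow> 1 \<le> t \<and> Q (t - 1) s"
  unfolding wp_def by (metis exec.Skip SkipE)

lemma wp_SEQ [simp]: "wp (SEQ c1 c2) Q t s \<longleftrightarrow> wp c1 (wp c2 Q) t s"
proof
  assume "wp (SEQ c1 c2) Q t s"
  then obtain u1 u2 r s' where
    "exec c1 s u1 r" "exec c2 r u2 s'" "u1 + u2 \<le> t" "Q (t - (u1 + u2)) s'"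
    unfolding wp_def by (blast elim: SeqE)
  then show "wp c1 (wp c2 Q) t s"
    unfolding wp_def
    by (intro exI[of _ u1] exI[of _ r] conjI exI[of _ u2] exI[of _ s']) auto
next
  assume "wp c1 (wp c2 Q) t s"
  then obtain u1 u2 r s' where
    "exec c1 s u1 r" "exec c2 r u2 s'" "u1 \<le> t" "u2 \<le> t - u1" "Q (t - u1 - u2) s'"
    unfolding wp_def by blast
  then show "wp (SEQ c1 c2) Q t s"
    unfolding wp_def
    by (intro exI[of _ "u1 + u2"] exI[of _ s'] conjI) (auto intro: exec.Seq)
qed

lemma wp_IF [simp]:
  "wp (IF b c1 c2) Q t s \<longleftrightarrow> 1 + bcost b \<le> t \<and>
     (if bval b s then wp c1 Q (t - (1 + bcost b)) s else wp c2 Q (t - (1 + bcost b)) s)"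
proof
  assume "wp (IF b c1 c2) Q t s"
  then obtain u s' where "exec (IF b c1 c2) s u s'" "u \<le> t" "Q (t - u) s'"
    unfolding wp_def by blast
  then obtain v where "exec (if bval b s then c1 else c2) s v s'" "1 + bcost b + v \<le> t"
      "Q (t - (1 + bcost b + v)) s'"
    by (auto elim!: IfE)
  then show "1 + bcost b \<le> t \<and>
     (if bval b s then wp c1 Q (t - (1 + bcost b)) s else wp c2 Q (t - (1 + bcost b)) s)"
    unfolding wp_def
    by (cases "bval b s") (auto intro!: exI[of _ v] exI[of _ s'])
next
  assume *: "1 + bcost b \<le> t \<and>
     (if bval b s then wp c1 Q (t - (1 + bcost b)) s else wp c2 Q (t - (1 + bcost b)) s)"
  then have "wp (if bval b s then c1 else c2) Q (t - (1 + bcost b)) s"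
    by (cases "bval b s") simp_all
  then obtain u s' where "exec (if bval b s then c1 else c2) s u s'" "u \<le> t - (1 + bcost b)"
      "Q (t - (1 + bcost b) - u) s'"
    unfolding wp_def by blast
  moreover from this(1) have "exec (IF b c1 c2) s (1 + bcost b + u) s'"
    using exec.IfTrue[of b s c1 u s' c2] exec.IfFalse[of b s c2 u s' c1] by (simp split: if_splits)
  ultimately show "wp (IF b c1 c2) Q t s"
    using * unfolding wp_def
    by (intro exI[of _ "1 + bcost b + u"] exI[of _ s'] conjI) auto
qed

text \<open>The credits serve as the variant, since evaluating the guard costs at least one of them.\<close>

lemma wp_WHILE:
  assumes "I t s"
    and step: "\<And>t s. I t s \<Longrightarrow> bval b s \<Longrightarrow> 1 + bcost b \<le> t \<and> wp c I (t - (1 + bcost b)) s"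
    and exit: "\<And>t s. I t s \<Longrightarrow> \<not> bval b s \<Longrightarrow> 1 + bcost b \<le> t \<and> Q (t - (1 + bcost b)) s"
  shows "wp (WHILE b c) Q t s"
  using assms(1)
proof (induction t arbitrary: s rule: less_induct)
  case (less t)
  show ?case
  proof (cases "bval b s")
    case True
    then obtain u r where u: "1 + bcost b \<le> t" "exec c s u r" "u \<le> t - (1 + bcost b)"
        "I (t - (1 + bcost b) - u) r"
      using step[OF less.prems] unfolding wp_def by blast
    then have "wp (WHILE b c) Q (t - (1 + bcost b) - u) r"
      by (intro less.IH) auto
    then obtain v s' where "exec (WHILE b c) r v s'" "v \<le> t - (1 + bcost b) - u"
        "Q (t - (1 + bcost b) - u - v) s'"
      unfolding wp_def by blast
    then show ?thesis
      using u True unfolding wp_def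
      by (intro exI[of _ "1 + bcost b + u + v"] exI[of _ s'] conjI)
        (auto intro: exec.WhileTrue[simplified])
  next
    case False
    then show ?thesis
      using exit[OF less.prems] unfolding wp_def
      by (intro exI[of _ "1 + bcost b"] exI[of _ s] conjI) (auto intro: exec.WhileFalse[simplified])
  qed
qed

section \<open>Merging\<close>

text \<open>Blocks are the classes of equal quotient by \<open>w\<close>, so a last block cut off by
  \<open>n\<close> is no special case.\<close>

definition block_sorted :: "nat \<Rightarrow> nat \<Rightarrow> (nat \<Rightarrow> real) \<Rightarrow> bool" where
  "block_sorted w n f \<longleftrightarrow> (\<forall>p q. p \<le> q \<and> q < n \<and> p div w = q div w \<longrightarrow> f p \<le> f q)"

text \<open>The blocks \<open>2m\<close> and \<open>2m + 1\<close> of \<open>A\<close>, of length \<open>w\<close>, are being merged into block \<open>m\<close> of \<open>B\<close>.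
  Their unread parts are \<open>{i..<mid}\<close> and \<open>{j..<hi}\<close>, and \<open>k\<close> entries of \<open>B\<close> have been written.\<close>

definition merging :: "nat \<Rightarrow> nat \<Rightarrow> (nat \<Rightarrow> real) \<Rightarrow> (nat \<Rightarrow> real) \<Rightarrow> nat \<Rightarrow>
    nat \<Rightarrow> nat \<Rightarrow> nat \<Rightarrow> nat \<Rightarrow> nat \<Rightarrow> bool" where
  "merging w n A B m i mid j hi k \<longleftrightarrow>
     m * (2 * w) \<le> i \<and> i \<le> mid \<and> mid \<le> j \<and> j \<le> hi \<and>
     mid = min (m * (2 * w) + w) n \<and> hi = min (m * (2 * w) + 2 * w) n \<and> k + mid = i + j \<and>
     B ` {..<k} = A ` ({..<i} \<union> {mid..<j}) \<and> block_sorted (2 * w) k B \<and>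
     (\<forall>p q. m * (2 * w) \<le> p \<and> p < k \<and> q \<in> {i..<mid} \<union> {j..<hi} \<longrightarrow> B p \<le> A q)"

text \<open>The state between two merges. Contents are compared as sets, not multisets, because a
  cover depends only on the set of points.\<close>

definition merged :: "nat \<Rightarrow> nat \<Rightarrow> (nat \<Rightarrow> real) \<Rightarrow> (nat \<Rightarrow> real) \<Rightarrow> nat \<Rightarrow> nat \<Rightarrow> bool" where
  "merged w n A B m k \<longleftrightarrow>
     k = min (m * (2 * w)) n \<and> B ` {..<k} = A ` {..<k} \<and> block_sorted (2 * w) k B"

lemma block_sorted_le:
  assumes "block_sorted w n f" "m * w \<le> p" "p \<le> q" "q < m * w + w" "q < n"
  shows "f p \<le> f q"
proof -
  have "p div w = m" "q div w = m"
    using assms by (auto intro!: div_nat_eqI simp: algebra_simps)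
  then show ?thesis
    using assms by (auto simp: block_sorted_def)
qed

lemma block_sorted_Suc:
  assumes "block_sorted w k f" "m * w \<le> k" "k < m * w + w"
    and "\<And>p. m * w \<le> p \<Longrightarrow> p < k \<Longrightarrow> f p \<le> x"
  shows "block_sorted w (Suc k) (f(k := x))"
  unfolding block_sorted_def
proof (intro allI impI, elim conjE)
  fix p q assume pq: "p \<le> q" "q < Suc k" "p div w = q div w"
  show "(f(k := x)) p \<le> (f(k := x)) q"
  proof (cases "q = k")
    case True
    have "k div w = m"
      using assms by (auto intro!: div_nat_eqI simp: algebra_simps)
    then have "m * w \<le> p"
      using pq True by (metis div_times_less_eq_dividend)
    then show ?thesis
      using assms(4)[of p] pq True by auto
  next
    case False
    then show ?thesis
      using pq assms(1) by (auto simp: block_sorted_def)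
  qed
qed

lemma merged_0: "merged w n A B 0 0"
  by (auto simp: merged_def block_sorted_def)

text \<open>Since \<open>k < n\<close>, the minimum in \<open>merged\<close> is not attained at
  \<open>n\<close>, so \<open>k\<close> is exactly the start of block \<open>m\<close>. The nested
  minima are those that \<open>next_block\<close> computes.\<close>

lemma merging_start:
  assumes "merged w n A B m k" "k < n"
  shows "merging w n A B m k (min (k + w) n) (min (k + w) n) (min (min (k + w) n + w) n) k"
proof -
  have "k = m * (2 * w)" "m * (2 * w) < n"
    using assms by (auto simp: merged_def min_def split: if_splits)
  then show ?thesis
    using assms by (simp add: merging_def merged_def)
qed

lemma merging_end:
  assumes "merging w n A B m i mid j hi hi"
  shows "merged w n A B (Suc m) hi"
proof -
  \<comment> \<open>With \<open>k = hi\<close>, the balance \<open>k + mid = i + j\<close> leaves no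
    room below the bounds \<open>i \<le> mid\<close> and \<open>j \<le> hi\<close>.\<close>
  have "i = mid" "j = hi" "mid \<le> j"
    using assms by (auto simp: merging_def)
  moreover from this have "{..<i} \<union> {mid..<j} = {..<hi}" by auto
  ultimately show ?thesis
    using assms by (auto simp: merging_def merged_def algebra_simps)
qed

text \<open>\<open>A i\<close> is a least unread entry: its own run is sorted, and the other run, if
  nonempty, starts with \<open>A j\<close>, which is no smaller.\<close>

lemma merging_left:
  assumes M: "merging w n A B m i mid j hi k" and A: "block_sorted w n A"
    and i: "i < mid" and le: "j < hi \<Longrightarrow> A i \<le> A j"
  shows "merging w n A (B(k := A i)) m (Suc i) mid j hi (Suc k)"
proof -
  let ?lo = "m * (2 * w)"
  have b: "?lo \<le> i" "mid \<le> j" "j \<le> hi" "mid = min (?lo + w) n" "hi = min (?lo + 2 * w) n"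
      "k + mid = i + j"
    using M unfolding merging_def by blast+
  have "block_sorted (2 * w) (Suc k) (B(k := A i))"
    using M i b by (intro block_sorted_Suc[of _ _ _ m]) (auto simp: merging_def)
  moreover have "(B(k := A i)) ` {..<Suc k} = A ` ({..<Suc i} \<union> {mid..<j})"
    using M by (auto simp: merging_def lessThan_Suc)
  moreover have "A i \<le> A q" if "q \<in> {Suc i..<mid} \<union> {j..<hi}" for q
  proof (cases "q < mid")
    case True
    then show ?thesis
      using that b by (intro block_sorted_le[OF A, of "2 * m"]) auto
  next
    case False
    then have q: "q \<in> {j..<hi}" using that by auto
    moreover have "A j \<le> A q"
    \<comment> \<open>If \<open>mid = n\<close>, the right run is empty; otherwise
      \<open>mid\<close> is the start of block \<open>2 * m + 1\<close> of width
      \<open>w\<close>.\<close>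
    proof (cases "mid = n")
      case False
      then show ?thesis
        using q b by (intro block_sorted_le[OF A, of "2 * m + 1"]) (auto simp: algebra_simps)
    qed (use q b in auto)
    ultimately show ?thesis
      using le by force
  qed
  moreover have "B p \<le> A q" if "?lo \<le> p" "p < k" "q \<in> {Suc i..<mid} \<union> {j..<hi}" for p q
    using M that unfolding merging_def by force
  ultimately show ?thesis
    using b i unfolding merging_def by (auto simp: less_Suc_eq)
qed

text \<open>The mirror image of \<open>merging_left\<close>. Here \<open>j < hi\<close> already
  forces \<open>mid < n\<close>, so the right run starts at a block boundary.\<close>

lemma merging_right:
  assumes M: "merging w n A B m i mid j hi k" and A: "block_sorted w n A"
    and j: "j < hi" and le: "i < mid \<Longrightarrow> A j \<le> A i"
  shows "merging w n A (B(k := A j)) m i mid (Suc j) hi (Suc k)"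
proof -
  let ?lo = "m * (2 * w)"
  have b: "?lo \<le> i" "i \<le> mid" "mid \<le> j" "mid = min (?lo + w) n" "hi = min (?lo + 2 * w) n"
      "k + mid = i + j"
    using M unfolding merging_def by blast+
  have "block_sorted (2 * w) (Suc k) (B(k := A j))"
    using M j b by (intro block_sorted_Suc[of _ _ _ m]) (auto simp: merging_def)
  moreover have "(B(k := A j)) ` {..<Suc k} = A ` ({..<i} \<union> {mid..<Suc j})"
    using M b by (auto simp: merging_def lessThan_Suc atLeastLessThanSuc)
  moreover have "A j \<le> A q" if "q \<in> {i..<mid} \<union> {Suc j..<hi}" for q
  proof (cases "q < mid")
    case True
    then have "A i \<le> A q"
      using that b by (intro block_sorted_le[OF A, of "2 * m"]) auto
    then show ?thesis
      using le True that b by force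
  next
    case False
    then show ?thesis
      using that b by (intro block_sorted_le[OF A, of "2 * m + 1"]) (auto simp: algebra_simps)
  qed
  moreover have "B p \<le> A q" if "?lo \<le> p" "p < k" "q \<in> {i..<mid} \<union> {Suc j..<hi}" for p q
    using M that unfolding merging_def by force
  ultimately show ?thesis
    using b j unfolding merging_def by (auto simp: less_Suc_eq)
qed

section \<open>Merge sort\<close>

text \<open>Integer cells serving as registers. Cell 0 is prescribed by the input and output format;
  \<open>rw\<close> holds the block width and \<open>rb\<close> the base address of the current
  array.\<close>

abbreviation (input) "rn \<equiv> 0 :: nat"
abbreviation (input) "rw \<equiv> 2 :: nat"
abbreviation (input) "rb \<equiv> 3 :: nat"
abbreviation (input) "ri \<equiv> 4 :: nat"
abbreviation (input) "rmid \<equiv> 5 :: nat"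
abbreviation (input) "rj \<equiv> 6 :: nat"
abbreviation (input) "rhi \<equiv> 7 :: nat"
abbreviation (input) "rk \<equiv> 8 :: nat"

abbreviation "reg x \<equiv> ICell (IConst x)"
abbreviation "assign x e \<equiv> IStore (IConst x) e"
abbreviation "incr x \<equiv> assign x (IPlus (reg x) (IConst 1))"
text \<open>The array being written lies directly behind the one being read, so the two are disjoint
  and a pass ends by moving the base.\<close>

abbreviation "src x \<equiv> IPlus (reg rb) (reg x)"
abbreviation "dst x \<equiv> IPlus (IPlus (reg rb) (reg rn)) (reg x)"

text \<open>Truncated subtraction gives \<open>min a n = a - (a - n)\<close>.\<close>

abbreviation "cap e \<equiv> IMinus e (IMinus e (reg rn))"

definition less_reg :: "nat \<Rightarrow> nat \<Rightarrow> bexp" where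
  "less_reg x y = ILess (reg x) (reg y)"

lemma bval_less_reg [simp]: "bval (less_reg x y) s \<longleftrightarrow> imem s x < imem s y"
  by (simp add: less_reg_def)

lemma bcost_less_reg [simp]: "bcost (less_reg x y) = 5"
  by (simp add: less_reg_def)

definition next_block :: com where
  "next_block =
     SEQ (assign ri (reg rk))
    (SEQ (assign rmid (cap (IPlus (reg rk) (reg rw))))
    (SEQ (assign rj (reg rmid))
         (assign rhi (cap (IPlus (reg rmid) (reg rw))))))"

definition take_left :: bexp where
  "take_left =
     BAnd (less_reg ri rmid)
          (BNot (BAnd (less_reg rj rhi) (RLess (RCell (src rj)) (RCell (src ri)))))"

definition move :: com where
  "move =
     SEQ (IF take_left
           (SEQ (RStore (dst rk) (RCell (src ri))) (incr ri))
           (SEQ (RStore (dst rk) (RCell (src rj))) (incr rj)))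
         (incr rk)"

text \<open>A single flat loop instead of a merge nested in a loop over blocks: each round writes
  exactly one entry, so no sum over blocks arises in the cost. Equality of \<open>rk\<close> and
  \<open>rhi\<close> means that a new block has to be opened, which the initial zeros ensure for the
  first round.\<close>

definition pass :: com where
  "pass =
     SEQ (assign rk (IConst 0))
    (SEQ (assign rhi (IConst 0))
    (SEQ (WHILE (less_reg rk rn)
           (SEQ (IF (less_reg rk rhi) SKIP next_block) move))
    (SEQ (assign rb (IPlus (reg rb) (reg rn)))
         (assign rw (IPlus (reg rw) (reg rw))))))"

definition sort_prog :: com where
  "sort_prog = SEQ (assign rw (IConst 1)) (WHILE (less_reg rw rn) pass)"

definition array :: "state \<Rightarrow> nat \<Rightarrow> nat \<Rightarrow> real" where
  "array s b p = rmem s (b + p)"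

lemma array_imem_update [simp]: "array (s\<lparr>imem := f\<rparr>) b = array s b"
  by (simp add: array_def fun_eq_iff)

definition config :: "nat \<Rightarrow> nat \<Rightarrow> nat \<Rightarrow> (nat \<Rightarrow> real) \<Rightarrow> state \<Rightarrow> bool" where
  "config n w b A s \<longleftrightarrow> imem s rn = n \<and> imem s rw = w \<and> imem s rb = b \<and> (\<forall>p<n. array s b p = A p)"

abbreviation "merging_state n w b A m s \<equiv>
  merging w n A (array s (b + n)) m
    (imem s ri) (imem s rmid) (imem s rj) (imem s rhi) (imem s rk)"

abbreviation "merged_state n w b A m s \<equiv>
  imem s rhi = imem s rk \<and> merged w n A (array s (b + n)) m (imem s rk)"

text \<open>The 40 is exact: two copies at 4 and two capped sums at 16.\<close>

lemma wp_next_block: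
  assumes "config n w b A s" "merged_state n w b A m s" "imem s rk < n" "w > 0" "t \<ge> 40"
    and Q: "\<And>t' s'. config n w b A s' \<Longrightarrow> merging_state n w b A m s' \<Longrightarrow>
      imem s' rk < imem s' rhi \<Longrightarrow> imem s' rk = imem s rk \<Longrightarrow> t' \<ge> t - 40 \<Longrightarrow> Q t' s'"
  shows "wp next_block Q t s"
proof -
  have cap: "a - (a - n) = min a n" for a by simp
  show ?thesis
    unfolding next_block_def
    using assms(1-5) merging_start[of w n A "array s (b + n)" m "imem s rk"]
    by (auto simp: config_def cap intro!: Q)
qed

lemma wp_move:
  assumes c: "config n w b A s" and M: "merging_state n w b A m s"
    and k: "imem s rk < imem s rhi" and A: "block_sorted w n A" and t: "t \<ge> 60"
    and Q: "\<And>t' s'. config n w b A s' \<Longrightarrow> merging_state n w b A m s' \<Longrightarrow>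
      imem s' rk = Suc (imem s rk) \<Longrightarrow> t' \<ge> t - 60 \<Longrightarrow> Q t' s'"
  shows "wp move Q t s"
proof -
  have b: "imem s ri \<le> imem s rmid" "imem s rmid \<le> imem s rj" "imem s rj \<le> imem s rhi"
      "imem s rmid \<le> n" "imem s rhi \<le> n" "imem s rk + imem s rmid = imem s ri + imem s rj"
    using M by (auto simp: merging_def)
  have regs: "imem s rn = n" "imem s rb = b"
    and rm: "\<And>p. p < n \<Longrightarrow> rmem s (b + p) = A p"
    using c by (auto simp: config_def array_def)
  have upd: "array (s\<lparr>rmem := (rmem s)(b + n + k := x)\<rparr>) (b + n) = (array s (b + n))(k := x)" for k x
    by (auto simp: array_def)
  \<comment> \<open>Writes land at or above \<open>b + n\<close>, hence outside the array
    \<open>A\<close> at \<open>b\<close>.\<close>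
  have config: "config n w b A
        (s\<lparr>rmem := (rmem s)(b + n + k := x), imem := (imem s)(i := y, rk := z)\<rparr>)"
      if "i = ri \<or> i = rj" for k x i y z
    using c that by (auto simp: array_def config_def)
  \<comment> \<open>Whenever the comparison of reals matters, both positions are below
    \<open>n\<close>, so memory may be replaced by \<open>A\<close>.\<close>
  have guard: "bval take_left s \<longleftrightarrow> imem s ri < imem s rmid \<and>
      \<not> (imem s rj < imem s rhi \<and> A (imem s rj) < A (imem s ri))"
    using b by (auto simp: take_left_def regs rm)
  have cost: "bcost take_left = 26"
    by (simp add: take_left_def)
  show ?thesis
  proof (cases "bval take_left s")
    case True
    then have "imem s ri < imem s rmid" "imem s rj < imem s rhi \<Longrightarrow> A (imem s ri) \<le> A (imem s rj)"
      by (auto simp: guard)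
    from merging_left[OF M A this] this(1) True b(4) t show ?thesis
      unfolding move_def
      by (simp add: cost regs rm) (auto intro!: Q simp: config upd)
  next
    case False
    \<comment> \<open>If the left run is exhausted, the balance gives \<open>j = k < hi\<close>;
      otherwise the failed guard itself gives \<open>j < hi\<close>.\<close>
    with k b(6) have "imem s rj < imem s rhi" "imem s ri < imem s rmid \<Longrightarrow> A (imem s rj) \<le> A (imem s ri)"
      by (auto simp: guard)
    from merging_right[OF M A this] this(1) False b(5) t show ?thesis
      unfolding move_def
      by (simp add: cost regs rm) (auto intro!: Q simp: config upd)
  qed
qed

text \<open>A round is charged 120: the two guards cost 6 each, opening a block 40, a move at most
  60.\<close>

lemma wp_pass:
  assumes c: "config n w b A s" and A: "block_sorted w n A" and w: "w > 0"
    and t: "t \<ge> 120 * n + 30"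
    and Q: "\<And>t' s' B. config n (2 * w) (b + n) B s' \<Longrightarrow> block_sorted (2 * w) n B \<Longrightarrow>
      B ` {..<n} = A ` {..<n} \<Longrightarrow> t' \<ge> t - (120 * n + 30) \<Longrightarrow> Q t' s'"
  shows "wp pass Q t s"
proof -
  \<comment> \<open>The first credit inequality bounds what was spent, the second what is left. The
    reserve 20 is exactly the failing guard (6) plus the two closing assignments (7 each).\<close>
  define I where "I t' s' \<longleftrightarrow> config n w b A s' \<and> imem s' rk \<le> n \<and>
     t' + 120 * imem s' rk + 10 \<ge> t \<and> t' \<ge> 120 * (n - imem s' rk) + 20 \<and>
     (\<exists>m. imem s' rk < imem s' rhi \<and> merging_state n w b A m s' \<or> merged_state n w b A m s')"
    for t' and s' :: state
  \<comment> \<open>Up to 52 credits of the round may be gone before the move. The constants 65 and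
    40 absorb them; 60 more for the move restores \<open>I\<close> at \<open>rk + 1\<close>.\<close>
  have move: "wp move I t' s'"
    if "config n w b A s'" "merging_state n w b A m s'" "imem s' rk < imem s' rhi"
      "t' + 120 * imem s' rk + 65 \<ge> t" "t' \<ge> 120 * (n - imem s' rk) - 40" for t' s' m
  proof -
    have k: "imem s' rk < n"
      using that by (auto simp: merging_def)
    show ?thesis
    proof (rule wp_move[OF that(1-3) A])
      show "60 \<le> t'" using that k by auto
      fix t'' s''
      assume *: "config n w b A s''" "merging_state n w b A m s''"
        "imem s'' rk = Suc (imem s' rk)" "t'' \<ge> t' - 60"
      have "imem s'' rk \<le> imem s'' rhi"
        using *(2) by (auto simp: merging_def)
      moreover have "merged_state n w b A (Suc m) s''" if "imem s'' rk = imem s'' rhi"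
        using merging_end *(2) that by metis
      ultimately have "\<exists>m. imem s'' rk < imem s'' rhi \<and> merging_state n w b A m s'' \<or>
          merged_state n w b A m s''"
        using *(2) by (metis le_neq_implies_less)
      moreover have "120 * (n - imem s' rk) = 120 * (n - imem s'' rk) + 120"
        using k *(3) by simp
      ultimately show "I t'' s''"
        unfolding I_def using * that(4,5) k by auto
    qed
  qed
  have loop: "wp (WHILE (less_reg rk rn)
           (SEQ (IF (less_reg rk rhi) SKIP next_block) move))
        (wp (SEQ (assign rb (IPlus (reg rb) (reg rn))) (assign rw (IPlus (reg rw) (reg rw)))) Q)
        (t - 6) (s\<lparr>imem := (imem s)(rk := 0, rhi := 0)\<rparr>)"
  proof (rule wp_WHILE[where I = I])
    show "I (t - 6) (s\<lparr>imem := (imem s)(rk := 0, rhi := 0)\<rparr>)"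
      unfolding I_def using c t by (auto simp: config_def intro: merged_0)
  next
    fix t' s'
    assume I: "I t' s'" and "bval (less_reg rk rn) s'"
    then have k: "imem s' rk < n" by (auto simp: I_def config_def)
    then have k': "120 * (n - imem s' rk) \<ge> 120" by simp
    from I have c': "config n w b A s'" and credit: "t' + 120 * imem s' rk + 10 \<ge> t"
        "t' \<ge> 120 * (n - imem s' rk) + 20"
      by (auto simp: I_def)
    obtain m where m: "imem s' rk < imem s' rhi \<and> merging_state n w b A m s' \<or>
        \<not> imem s' rk < imem s' rhi \<and> merged_state n w b A m s'"
      using I unfolding I_def by auto
    then have "wp (SEQ (IF (less_reg rk rhi) SKIP next_block) move) I (t' - 6) s'"
      if "t' \<ge> 60"
    proof
      assume "imem s' rk < imem s' rhi \<and> merging_state n w b A m s'"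
      then show ?thesis
        using c' credit k' that by (auto intro!: move[of _ m])
    next
      assume *: "\<not> imem s' rk < imem s' rhi \<and> merged_state n w b A m s'"
      have "wp next_block (wp move I) (t' - 12) s'"
      proof (rule wp_next_block[OF c' conjunct2[OF *] k w])
        show "40 \<le> t' - 12" using that by simp
        fix t'' s''
        assume "config n w b A s''" "merging_state n w b A m s''" "imem s'' rk < imem s'' rhi"
          "imem s'' rk = imem s' rk" "t'' \<ge> t' - 12 - 40"
        then show "wp move I t'' s''"
          using credit k' by (intro move) auto
      qed
      then show ?thesis
        using * that by auto
    qed
    then show "1 + bcost (less_reg rk rn) \<le> t' \<and>
        wp (SEQ (IF (less_reg rk rhi) SKIP next_block) move) I
          (t' - (1 + bcost (less_reg rk rn))) s'"
      using credit k' by (simp del: wp_SEQ)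
  next
    fix t' s'
    assume I: "I t' s'" and "\<not> bval (less_reg rk rn) s'"
    then have k: "imem s' rk = n" by (auto simp: I_def config_def)
    \<comment> \<open>\<open>rhi\<close> is capped by \<open>n\<close>, so no merge is in progress
      once \<open>rk = n\<close>.\<close>
    have "\<not> (imem s' rk < imem s' rhi \<and> merging_state n w b A m s')" for m
      by (auto simp: merging_def k)
    then obtain m where m: "merged_state n w b A m s'"
      using I unfolding I_def by blast
    let ?s = "s'\<lparr>imem := (imem s')(rb := b + n, rw := 2 * w)\<rparr>"
    have "Q (t' - 20) ?s" if "20 \<le> t'" "t' + 120 * n + 10 \<ge> t"
    proof (rule Q[of "array s' (b + n)"])
      show "config n (2 * w) (b + n) (array s' (b + n)) ?s"
        using I by (auto simp: I_def config_def)
      show "block_sorted (2 * w) n (array s' (b + n))"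
          "array s' (b + n) ` {..<n} = A ` {..<n}"
        using m by (auto simp: merged_def k)
    qed (use that in auto)
    moreover have "t' \<ge> 20" "t' + 120 * n + 10 \<ge> t"
      using I by (auto simp: I_def k)
    moreover have "imem s' rb = b" "imem s' rw = w" "imem s' rn = n"
      using I by (auto simp: I_def config_def)
    ultimately show "1 + bcost (less_reg rk rn) \<le> t' \<and>
      wp (SEQ (assign rb (IPlus (reg rb) (reg rn))) (assign rw (IPlus (reg rw) (reg rw)))) Q
        (t' - (1 + bcost (less_reg rk rn))) s'"
      by (simp add: mult_2) linarith
  qed
  then show ?thesis
    unfolding pass_def using t by (auto simp: wp_IStore_const simp del: wp_IStore)
qed

text \<open>\<open>r\<close> bounds the number of passes still to come: a pass doubles
  \<open>w\<close> and lowers \<open>r\<close> by one, which preserves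
  \<open>n \<le> w * 2 ^ r\<close>. The \<open>K\<close> credits are reserved for the
  continuation.\<close>

lemma wp_sort_prog:
  assumes s: "imem s rn = n" "imem s rb = 0" "\<forall>p<n. rmem s p = A p"
    and r: "n \<le> 2 ^ r" and t: "t \<ge> r * (120 * n + 40) + K + 20"
    and Q: "\<And>t' s' w b B. config n w b B s' \<Longrightarrow> (\<And>p q. p \<le> q \<Longrightarrow> q < n \<Longrightarrow> B p \<le> B q) \<Longrightarrow>
      B ` {..<n} = A ` {..<n} \<Longrightarrow> t' \<ge> K \<Longrightarrow> Q t' s'"
  shows "wp sort_prog Q t s"
proof -
  define I where "I t' s' \<longleftrightarrow> (\<exists>w b B r. config n w b B s' \<and> w > 0 \<and> block_sorted w n B \<and>
      B ` {..<n} = A ` {..<n} \<and> n \<le> w * 2 ^ r \<and> t' \<ge> r * (120 * n + 40) + K + 10)" for t' and s' :: state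
  have "wp (WHILE (less_reg rw rn) pass) Q (t - 3) (s\<lparr>imem := (imem s)(rw := 1)\<rparr>)"
  proof (rule wp_WHILE[where I = I])
    have "config n 1 0 A (s\<lparr>imem := (imem s)(rw := 1)\<rparr>)"
      using s by (simp add: config_def array_def)
    moreover have "block_sorted 1 n A"
      by (auto simp: block_sorted_def)
    ultimately show "I (t - 3) (s\<lparr>imem := (imem s)(rw := 1)\<rparr>)"
      unfolding I_def using r t
      by (intro exI[of _ 1] exI[of _ 0] exI[of _ A] exI[of _ r]) auto
  next
    fix t' s'
    assume "I t' s'" and guard: "bval (less_reg rw rn) s'"
    then obtain w b B r where I: "config n w b B s'" "w > 0" "block_sorted w n B"
      "B ` {..<n} = A ` {..<n}" "n \<le> w * 2 ^ r" "t' \<ge> r * (120 * n + 40) + K + 10"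
      unfolding I_def by blast
    \<comment> \<open>For \<open>r = 0\<close> the bound reads \<open>n \<le> w\<close>,
      contradicting the guard.\<close>
    from I(1,5) guard obtain r' where r': "r = Suc r'"
      by (cases r) (auto simp: config_def)
    have "wp pass I (t' - 6) s'"
    proof (rule wp_pass[OF I(1,3,2)])
      show "120 * n + 30 \<le> t' - 6"
        using I(6) r' by simp
      fix t'' s'' B'
      assume "config n (2 * w) (b + n) B' s''" "block_sorted (2 * w) n B'"
        "B' ` {..<n} = B ` {..<n}" "t' - 6 - (120 * n + 30) \<le> t''"
      then show "I t'' s''"
        unfolding I_def using I r'
        by (intro exI[of _ "2 * w"] exI[of _ "b + n"] exI[of _ B'] exI[of _ r']) auto
    qed
    then show "1 + bcost (less_reg rw rn) \<le> t' \<and>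
        wp pass I (t' - (1 + bcost (less_reg rw rn))) s'"
      using I(6) by simp
  next
    fix t' s'
    assume "I t' s'" and guard: "\<not> bval (less_reg rw rn) s'"
    then obtain w b B r where I: "config n w b B s'" "w > 0" "block_sorted w n B"
      "B ` {..<n} = A ` {..<n}" "t' \<ge> r * (120 * n + 40) + K + 10"
      unfolding I_def by blast
    from I(1) guard have "n \<le> w"
      by (auto simp: config_def)
    \<comment> \<open>Block 0 now contains the whole array.\<close>
    then have "B p \<le> B q" if "p \<le> q" "q < n" for p q
      using that block_sorted_le[OF I(3), of 0 p q] by auto
    then have "Q (t' - 6) s'"
      using I by (intro Q[of w b B]) auto
    then show "1 + bcost (less_reg rw rn) \<le> t' \<and>
        Q (t' - (1 + bcost (less_reg rw rn))) s'"
      using I(5) by simp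
  qed
  then show ?thesis
    unfolding sort_prog_def using t by (auto simp: wp_IStore_const simp del: wp_IStore)
qed

section \<open>Greedy covering\<close>

text \<open>The scan after \<open>i\<close> points, with \<open>m\<close> intervals opened.
  Optimality rests on the left endpoints being scanned points; the strict gaps give both
  disjointness and the lower bound.\<close>

definition greedy :: "(nat \<Rightarrow> real) \<Rightarrow> nat \<Rightarrow> nat \<Rightarrow> (nat \<Rightarrow> real) \<Rightarrow> bool" where
  "greedy A i m C \<longleftrightarrow> m \<le> i \<and> C ` {..<m} \<subseteq> A ` {..<i} \<and>
     (\<forall>p q. p < q \<and> q < m \<longrightarrow> C p + 1 < C q) \<and> (\<forall>p<i. \<exists>q<m. A p \<in> unit_interval (C q))"

lemma greedy_skip:
  assumes "greedy A i m C" "m > 0" "A i \<le> C (m - 1) + 1" and A: "\<And>p. p < i \<Longrightarrow> A p \<le> A i"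
  shows "greedy A (Suc i) m C"
proof -
  \<comment> \<open>The last left endpoint is a scanned point, so sortedness puts it at or below
    \<open>A i\<close>.\<close>
  have "C (m - 1) \<in> A ` {..<i}"
    using assms(1,2) by (auto simp: greedy_def image_subset_iff)
  then have "A i \<in> unit_interval (C (m - 1))"
    using A assms(3) by (auto simp: unit_interval_def)
  then show ?thesis
    using assms(1,2) by (auto simp: greedy_def less_Suc_eq lessThan_Suc intro!: exI[of _ "m - 1"])
qed

lemma greedy_add:
  assumes "greedy A i m C" "m > 0 \<Longrightarrow> C (m - 1) + 1 < A i"
  shows "greedy A (Suc i) (Suc m) (C(m := A i))"
proof -
  have "C p + 1 < A i" if "p < m" for p
  proof (cases "p = m - 1")
    case False
    then have "C p + 1 < C (m - 1)"
      using that assms(1) by (auto simp: greedy_def)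
    then show ?thesis
      using that assms(2) by linarith
  qed (use that assms in auto)
  moreover have "\<exists>q<Suc m. A p \<in> unit_interval ((C(m := A i)) q)" if p: "p < Suc i" for p
  proof (cases "p = i")
    case True
    then show ?thesis
      by (intro exI[of _ m]) (simp add: unit_interval_def)
  next
    case False
    then obtain q where "q < m" "A p \<in> unit_interval (C q)"
      using p assms(1) unfolding greedy_def by (metis less_antisym)
    then show ?thesis
      by (intro exI[of _ q]) simp
  qed
  ultimately show ?thesis
    using assms(1) by (auto simp: greedy_def less_Suc_eq lessThan_Suc)
qed

text \<open>Sending each left endpoint to an interval of \<open>T\<close> that contains it is
  injective, which bounds \<open>card T\<close> from below. Injectivity of \<open>C\<close> is what
  makes the output list free of repetitions.\<close>

lemma greedy_optimal:
  assumes g: "greedy A n m C" and P: "P = A ` {..<n}"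
  shows "min_one_ply_cover P (unit_interval ` C ` {..<m})" and "inj_on C {..<m}"
proof -
  have sep: "C p + 1 < C q" if "p < q" "q < m" for p q
    using g that by (auto simp: greedy_def)
  show inj: "inj_on C {..<m}"
  proof (rule linorder_inj_onI)
    fix p q
    assume "p < q" "q \<in> {..<m}"
    then show "C p \<noteq> C q"
      using sep[of p q] by auto
  qed auto
  let ?S = "unit_interval ` C ` {..<m}"
  have disj: "p = q" if "x \<in> unit_interval (C p)" "x \<in> unit_interval (C q)" "p < m" "q < m" for x p q
    using that sep[of p q] sep[of q p]
    by (cases p q rule: linorder_cases) (auto simp: unit_interval_def)
  have le: "card {s \<in> ?S. x \<in> s} \<le> 1" for x
  proof (rule card_le_Suc0_iff_eq[THEN iffD2, folded One_nat_def])
    show "\<forall>a\<in>{s \<in> ?S. x \<in> s}. \<forall>b\<in>{s \<in> ?S. x \<in> s}. a = b"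
      using disj by blast
  qed simp
  \<comment> \<open>\<open>Max\<close> ranges over all real points, so the set of counts must first
    be shown finite.\<close>
  then have "range (\<lambda>x. card {s \<in> ?S. x \<in> s}) \<subseteq> {..1}"
    by blast
  then have "finite (range (\<lambda>x. card {s \<in> ?S. x \<in> s}))"
    by (rule finite_subset) simp
  then have "ply ?S \<le> 1"
    unfolding ply_def by (rule Max.boundedI) (use le in blast)+
  moreover have "P \<subseteq> \<Union>?S"
    using g unfolding greedy_def P by blast
  ultimately have cover: "one_ply_cover P ?S"
    by (auto simp: one_ply_cover_def)
  have "card ?S \<le> card T" if T: "one_ply_cover P T" for T
  proof -
    have "\<exists>s\<in>T. C p \<in> s" if "p < m" for p
    proof -
      have "C p \<in> P"
        using g that by (auto simp: greedy_def P image_subset_iff)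
      then show ?thesis
        using T by (auto simp: one_ply_cover_def)
    qed
    then obtain f where f: "\<And>p. p < m \<Longrightarrow> f p \<in> T \<and> C p \<in> f p"
      by metis
    \<comment> \<open>Two points more than 1 apart cannot share a unit interval.\<close>
    have "f p \<noteq> f q" if "p < q" "q < m" for p q
    proof
      assume "f p = f q"
      then have "C p \<in> f p" "C q \<in> f p" "f p \<in> range unit_interval"
        using f[of p] f[of q] that T by (auto simp: one_ply_cover_def)
      then show False
        using sep[OF that] by (auto simp: unit_interval_def)
    qed
    then have "inj_on f {..<m}"
      by (intro linorder_inj_onI) auto
    then have "m \<le> card T"
      using card_inj_on_le[of f "{..<m}" T] f T by (auto simp: one_ply_cover_def)
    moreover have "card ?S \<le> m"
      using card_image_le[of "{..<m}" "unit_interval \<circ> C"] by (simp add: image_comp)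
    ultimately show ?thesis by simp
  qed
  with cover show "min_one_ply_cover P ?S"
    by (auto simp: min_one_ply_cover_def is_arg_min_def not_less)
qed

text \<open>A point at distance exactly 1 is still covered, hence the negated strict comparison. At
  \<open>rk = 0\<close> truncated subtraction makes the index 0, and the first conjunct discards
  that reading.\<close>

definition last_covers :: bexp where
  "last_covers =
     BAnd (ILess (IConst 0) (reg rk))
          (BNot (RLess (RPlus (RCell (IMinus (reg rk) (IConst 1))) (RConst 1)) (RCell (src ri))))"

definition greedy_prog :: com where
  "greedy_prog =
     SEQ (assign rk (IConst 0))
    (SEQ (assign ri (IConst 0))
    (SEQ (WHILE (less_reg ri rn)
           (SEQ (IF last_covers SKIP (SEQ (RStore (reg rk) (RCell (src ri))) (incr rk)))
                (incr ri)))
         (assign rn (reg rk))))"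

text \<open>The output overwrites the array only behind the read position, since \<open>m \<le> i\<close>.\<close>

lemma wp_greedy_prog:
  assumes c: "config n w b A s" and A: "\<And>p q. p \<le> q \<Longrightarrow> q < n \<Longrightarrow> A p \<le> A q"
    and t: "t \<ge> 60 * n + 30"
    and Q: "\<And>t' s'. greedy A n (imem s' rn) (rmem s') \<Longrightarrow> Q t' s'"
  shows "wp greedy_prog Q t s"
proof -
  \<comment> \<open>Only the unread part of \<open>A\<close> is kept in memory. A round costs at
    most 48 (guard 6, test 21, store 9, two increments 12), and leaving the loop with the final
    assignment costs 10.\<close>
  define I where "I t' s' \<longleftrightarrow> imem s' rn = n \<and> imem s' rb = b \<and> imem s' ri \<le> n \<and>
     (\<forall>p. imem s' ri \<le> p \<and> p < n \<longrightarrow> rmem s' (b + p) = A p) \<and>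
     greedy A (imem s' ri) (imem s' rk) (rmem s') \<and> t' \<ge> 60 * (n - imem s' ri) + 15" for t' and s' :: state
  have "wp (WHILE (less_reg ri rn)
           (SEQ (IF last_covers SKIP (SEQ (RStore (reg rk) (RCell (src ri))) (incr rk)))
                (incr ri)))
         (wp (assign rn (reg rk)) Q) (t - 6) (s\<lparr>imem := (imem s)(rk := 0, ri := 0)\<rparr>)"
  proof (rule wp_WHILE[where I = I])
    show "I (t - 6) (s\<lparr>imem := (imem s)(rk := 0, ri := 0)\<rparr>)"
      unfolding I_def using c t by (auto simp: config_def array_def greedy_def)
  next
    fix t' s'
    assume I: "I t' s'" and "bval (less_reg ri rn) s'"
    then have i: "imem s' ri < n" by (auto simp: I_def)
    then have time: "60 * (n - imem s' ri) = 60 * (n - Suc (imem s' ri)) + 60" by simp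
    have regs: "imem s' rn = n" "imem s' rb = b" and rm: "rmem s' (b + imem s' ri) = A (imem s' ri)"
      and g: "greedy A (imem s' ri) (imem s' rk) (rmem s')" and t': "t' \<ge> 60 * (n - imem s' ri) + 15"
      and rest: "\<And>p. imem s' ri \<le> p \<Longrightarrow> p < n \<Longrightarrow> rmem s' (b + p) = A p"
      using I i by (auto simp: I_def)
    have k: "imem s' rk \<le> imem s' ri"
      using g by (simp add: greedy_def)
    have guard: "bval last_covers s' \<longleftrightarrow>
        imem s' rk > 0 \<and> A (imem s' ri) \<le> rmem s' (imem s' rk - 1) + 1"
      by (auto simp: last_covers_def regs rm)
    have cost: "bcost last_covers = 20"
      by (simp add: last_covers_def)
    have "wp (SEQ (IF last_covers SKIP (SEQ (RStore (reg rk) (RCell (src ri))) (incr rk)))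
        (incr ri)) I (t' - 6) s'"
    proof (cases "bval last_covers s'")
      case True
      then have "greedy A (Suc (imem s' ri)) (imem s' rk) (rmem s')"
        using g A i by (intro greedy_skip) (auto simp: guard)
      then show ?thesis
        using True t' time i rest by (simp add: cost) (auto simp: I_def regs)
    next
      case False
      then have "greedy A (Suc (imem s' ri)) (Suc (imem s' rk))
          ((rmem s')(imem s' rk := A (imem s' ri)))"
        using g by (intro greedy_add) (auto simp: guard)
      then show ?thesis
        using False t' time i rest k by (simp add: cost regs rm) (auto simp: I_def regs)
    qed
    then show "1 + bcost (less_reg ri rn) \<le> t' \<and>
        wp (SEQ (IF last_covers SKIP (SEQ (RStore (reg rk) (RCell (src ri))) (incr rk)))
          (incr ri)) I (t' - (1 + bcost (less_reg ri rn))) s'"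
      using t' by (simp del: wp_SEQ)
  next
    fix t' s'
    assume "I t' s'" "\<not> bval (less_reg ri rn) s'"
    then have "greedy A n (imem s' rk) (rmem s')" "t' \<ge> 15"
      by (auto simp: I_def)
    then show "1 + bcost (less_reg ri rn) \<le> t' \<and>
        wp (assign rn (reg rk)) Q (t' - (1 + bcost (less_reg ri rn))) s'"
      by (auto intro!: Q)
  qed
  then show ?thesis
    unfolding greedy_prog_def using t by (auto simp: wp_IStore_const simp del: wp_IStore)
qed

section \<open>The running time\<close>

text \<open>\<open>ceillog2 n\<close> passes, the credits demanded by \<open>wp_greedy_prog\<close>,
  and the overhead 20 of \<open>wp_sort_prog\<close>.\<close>

definition time_bound :: "nat \<Rightarrow> nat" where
  "time_bound n = ceillog2 n * (120 * n + 40) + (60 * n + 30) + 20"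

lemma time_bound_bigo: "(\<lambda>n. real (time_bound n)) \<in> O(\<lambda>n. real n * ln (real n))"
proof (rule bigoI)
  show "\<forall>\<^sub>F n in sequentially.
      norm (real (time_bound n)) \<le> 1000 * norm (real n * ln (real n))"
    \<comment> \<open>From 3 \<ge> exp 1 on, the logarithm is at least 1 and can absorb additive
      constants.\<close>
    using eventually_ge_at_top[of 3]
  proof eventually_elim
    case (elim n)
    have "1 \<le> ln (real n)"
      using elim exp_le by (subst ln_ge_iff) auto
    \<comment> \<open>This is \<open>ln x \<le> x - 1\<close> at \<open>x = 1 / 2\<close>.\<close>
    have "1 / 2 \<le> ln (2::real)"
      using ln_le_minus_one[of "1 / 2"] by (simp add: ln_div)
    then have "log 2 (real n) \<le> 2 * ln (real n)"
      using \<open>1 \<le> ln (real n)\<close> mult_left_mono[of "1/2" "ln 2" "2 * ln (real n)"]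
      by (simp add: log_def field_simps)
    then have "real (ceillog2 n) \<le> 3 * ln (real n)"
      using ceillog2_less_log[of n] elim \<open>1 \<le> ln (real n)\<close> by linarith
    then have "real (ceillog2 n) * (120 * real n + 40) \<le> 3 * ln (real n) * (160 * real n)"
      using elim \<open>1 \<le> ln (real n)\<close> by (intro mult_mono) auto
    moreover have "60 * real n + 50 \<le> ln (real n) * (110 * real n)"
    proof -
      have "60 * real n + 50 \<le> 1 * (110 * real n)" using elim by simp
      also have "\<dots> \<le> ln (real n) * (110 * real n)"
        using \<open>1 \<le> ln (real n)\<close> by (intro mult_right_mono) auto
      finally show ?thesis .
    qed
    \<comment> \<open>590 = 3 * 160 + 110.\<close>
    ultimately have "real (time_bound n) \<le> 590 * (real n * ln (real n))"
      by (simp add: time_bound_def algebra_simps)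
    moreover have "0 \<le> real n * ln (real n)"
      using \<open>1 \<le> ln (real n)\<close> by simp
    ultimately show ?case by simp
  qed
qed

text \<open>\<open>prog\<close> and \<open>T\<close> are chosen before the input, so one program
  serves all lengths and all orders of the points. By \<open>exec_deterministic\<close> the run
  exhibited is the only one.\<close>

theorem lemma1:
  "\<exists>(prog :: com) (T :: nat \<Rightarrow> nat).
     (\<lambda>n. real (T n)) \<in> O(\<lambda>n. real n * ln (real n)) \<and>
     (\<forall>(P :: real set) (xs :: real list). distinct xs \<and> set xs = P \<longrightarrow>
        (\<exists>t s. exec prog (input_state xs) t s \<and>
               t \<le> T (card P) \<and>
               distinct (output_list s) \<and>
               min_one_ply_cover P (unit_interval ` set (output_list s))))"
proof (rule exI[of _ "SEQ sort_prog greedy_prog"], rule exI[of _ time_bound],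
    intro conjI allI impI)
  show "(\<lambda>n. real (time_bound n)) \<in> O(\<lambda>n. real n * ln (real n))"
    by (rule time_bound_bigo)
next
  fix P :: "real set" and xs :: "real list"
  assume "distinct xs \<and> set xs = P"
  then have n: "card P = length xs" and P: "P = (!) xs ` {..<length xs}"
    using distinct_card[of xs] by (auto simp: set_conv_nth)
  let ?good = "\<lambda>s. distinct (output_list s) \<and>
    min_one_ply_cover P (unit_interval ` set (output_list s))"
  \<comment> \<open>Stated for any array \<open>A\<close> with entries \<open>P\<close>, since the
    greedy scan reads a sorted copy and not \<open>xs\<close>.\<close>
  have good: "?good s" if "greedy A (length xs) (imem s 0) (rmem s)" "P = A ` {..<length xs}" for A s
  proof -
    have "set (output_list s) = rmem s ` {..<imem s 0}"
      by (auto simp: output_list_def)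
    then show ?thesis
      using greedy_optimal[OF that]
      by (auto simp: output_list_def distinct_map atLeast0LessThan)
  qed
  have "wp (SEQ sort_prog greedy_prog) (\<lambda>t. ?good) (time_bound (length xs)) (input_state xs)"
    unfolding wp_SEQ
  proof (rule wp_sort_prog[where A = "(!) xs" and n = "length xs" and
        r = "ceillog2 (length xs)" and K = "60 * length xs + 30"])
    show "length xs \<le> 2 ^ ceillog2 (length xs)"
      by (rule le_two_power_ceillog2)
    show "ceillog2 (length xs) * (120 * length xs + 40) + (60 * length xs + 30) + 20
        \<le> time_bound (length xs)"
      by (simp add: time_bound_def)
    fix t s w b B
    assume "config (length xs) w b B s" "\<And>p q. p \<le> q \<Longrightarrow> q < length xs \<Longrightarrow> B p \<le> B q"
      "B ` {..<length xs} = (!) xs ` {..<length xs}" "60 * length xs + 30 \<le> t"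
    then show "wp greedy_prog (\<lambda>t. ?good) t s"
      by (intro wp_greedy_prog[of _ w b B s] good[of B]) (auto simp: P)
  qed (auto simp: input_state_def)
  then show "\<exists>t s. exec (SEQ sort_prog greedy_prog) (input_state xs) t s \<and>
      t \<le> time_bound (card P) \<and> distinct (output_list s) \<and>
      min_one_ply_cover P (unit_interval ` set (output_list s))"
    unfolding wp_def n by blast
qed

end
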